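(* Let $n\ge2$ with $n\equiv 2$ or $3\pmod 4$. Any $\mathrm{OA}(n+1,n)$ has at least $\lceil n/4\rceil$ equiparity Latin squares in its ensemble.
   Context: An orthogonal array $\mathrm{OA}(k,n)$ on an alphabet $\Lambda$ with $|\Lambda|=n$ is an $n^2\times k$ matrix $A=(a_{r\ell})$ with entries in $\Lambda$ such that in every pair of distinct columns each ordered pair in $\Lambda^2$ occurs in exactly one row. The ensemble of $A$ is the family of Latin squares indexed by the $\binom{k}{3}$ choices of columns $i<j<\ell$ of $A$ (Latin squares are counted once for each choice of three columns): the Latin square for $i<j<\ell$ has rows and columns indexed by $\Lambda$, and for each row $r$ of $A$ its entry in row $a_{ri}$, column $a_{rj}$ is $a_{r\ell}$. For a Latin square $L=(l_{xy})$ with rows, columns and symbols indexed by $\Lambda$, the row-parity $\pi_r\in\mathbb{Z}_2$ is the sum of the parities ($0$ even, $1$ odd) of the $n$ permutations $y\mapsto l_{xy}$ ($x\in\Lambda$ fixed); the column-parity $\pi_c$ is the sum of the parities of the $n$ permutations $x\mapsto l_{xy}$ ($y$ fixed); the symbol-parity $\pi_s$ is the sum of the parities of the $n$ permutations mapping $x\mapsto y$ whenever $l_{xy}=s$ ($s$ fixed). $L$ is equiparity if $\pi_r=\pi_c=\pi_s$. *)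

theory Defs
  imports Complex_Main "HOL-Combinatorics.Combinatorics" "HOL-Library.Z2" "HOL-Number_Theory.Cong"
begin

text \<open>
  An orthogonal array is an \<open>n\<^sup>2 \<times> k\<close> matrix \<open>A\<close>, whose rows are indexed by \<open>{..<n\<^sup>2}\<close> and
  whose columns are indexed by \<open>{..<k}\<close>; values of \<open>A\<close> outside this range are irrelevant.
\<close>

definition orthogonal_array :: "nat \<Rightarrow> nat \<Rightarrow> 'a set \<Rightarrow> (nat \<Rightarrow> nat \<Rightarrow> 'a) \<Rightarrow> bool" where
  "orthogonal_array k n \<Lambda> A \<longleftrightarrow>
     finite \<Lambda> \<and> card \<Lambda> = n \<and>
     (\<forall>r<n^2. \<forall>l<k. A r l \<in> \<Lambda>) \<and>
     (\<forall>i<k. \<forall>j<k. i \<noteq> j \<longrightarrow>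
        (\<forall>x\<in>\<Lambda>. \<forall>y\<in>\<Lambda>. \<exists>!r. r < n^2 \<and> A r i = x \<and> A r j = y))"

definition latin_square :: "'a set \<Rightarrow> ('a \<Rightarrow> 'a \<Rightarrow> 'a) \<Rightarrow> bool" where
  "latin_square \<Lambda> L \<longleftrightarrow>
     (\<forall>x\<in>\<Lambda>. bij_betw (\<lambda>y. L x y) \<Lambda> \<Lambda>) \<and>
     (\<forall>y\<in>\<Lambda>. bij_betw (\<lambda>x. L x y) \<Lambda> \<Lambda>)"

definition ensemble_square ::
    "nat \<Rightarrow> (nat \<Rightarrow> nat \<Rightarrow> 'a) \<Rightarrow> nat \<Rightarrow> nat \<Rightarrow> nat \<Rightarrow> 'a \<Rightarrow> 'a \<Rightarrow> 'a" where
  "ensemble_square n A i j l x y = A (THE r. r < n^2 \<and> A r i = x \<and> A r j = y) l"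

definition ensemble_index :: "nat \<Rightarrow> (nat \<times> nat \<times> nat) set" where
  "ensemble_index k = {(i, j, l). i < j \<and> j < l \<and> l < k}"

text \<open>
  The parity of a bijection of \<open>\<Lambda>\<close> is that of the permutation which agrees with it on \<open>\<Lambda>\<close>
  and fixes every other element of the type.
\<close>

definition parity_on :: "'a set \<Rightarrow> ('a \<Rightarrow> 'a) \<Rightarrow> bit" where
  "parity_on \<Lambda> f = (if evenperm (restrict_id f \<Lambda>) then 0 else 1)"

definition row_parity :: "'a set \<Rightarrow> ('a \<Rightarrow> 'a \<Rightarrow> 'a) \<Rightarrow> bit" where
  "row_parity \<Lambda> L = (\<Sum>x\<in>\<Lambda>. parity_on \<Lambda> (\<lambda>y. L x y))"

definition column_parity :: "'a set \<Rightarrow> ('a \<Rightarrow> 'a \<Rightarrow> 'a) \<Rightarrow> bit" where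
  "column_parity \<Lambda> L = (\<Sum>y\<in>\<Lambda>. parity_on \<Lambda> (\<lambda>x. L x y))"

definition symbol_parity :: "'a set \<Rightarrow> ('a \<Rightarrow> 'a \<Rightarrow> 'a) \<Rightarrow> bit" where
  "symbol_parity \<Lambda> L = (\<Sum>s\<in>\<Lambda>. parity_on \<Lambda> (\<lambda>x. THE y. y \<in> \<Lambda> \<and> L x y = s))"

definition equiparity_latin_square :: "'a set \<Rightarrow> ('a \<Rightarrow> 'a \<Rightarrow> 'a) \<Rightarrow> bool" where
  "equiparity_latin_square \<Lambda> L \<longleftrightarrow>
     latin_square \<Lambda> L \<and>
     row_parity \<Lambda> L = column_parity \<Lambda> L \<and> column_parity \<Lambda> L = symbol_parity \<Lambda> L"

lemma latin_square_ensemble_square: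
  assumes oa: "orthogonal_array k n \<Lambda> A" and ijl: "(i, j, l) \<in> ensemble_index k"
  shows "latin_square \<Lambda> (ensemble_square n A i j l)"
proof -
  let ?L = "ensemble_square n A i j l"
  have lt: "i < k" "j < k" "l < k" "i \<noteq> j" "i \<noteq> l" "j \<noteq> l"
    using ijl by (auto simp: ensemble_index_def)
  have fin: "finite \<Lambda>" and ent: "\<And>r c. r < n^2 \<Longrightarrow> c < k \<Longrightarrow> A r c \<in> \<Lambda>"
    using oa by (auto simp: orthogonal_array_def)
  have ex1: "\<exists>!r. r < n^2 \<and> A r c = x \<and> A r d = y"
    if "c < k" "d < k" "c \<noteq> d" "x \<in> \<Lambda>" "y \<in> \<Lambda>" for c d x y
    using oa that by (auto simp: orthogonal_array_def)
  have row: "\<exists>r<n^2. A r i = x \<and> A r j = y \<and> ?L x y = A r l" if "x \<in> \<Lambda>" "y \<in> \<Lambda>" for x y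
    using theI'[OF ex1[OF lt(1,2,4) that]] by (auto simp: ensemble_square_def)
  have cl: "?L x y \<in> \<Lambda>" if "x \<in> \<Lambda>" "y \<in> \<Lambda>" for x y
    using row[OF that] ent lt(3) by auto
  have "bij_betw (\<lambda>y. ?L x y) \<Lambda> \<Lambda>" if x: "x \<in> \<Lambda>" for x
  proof -
    have "inj_on (\<lambda>y. ?L x y) \<Lambda>"
    proof (rule inj_onI)
      fix y z assume yz: "y \<in> \<Lambda>" "z \<in> \<Lambda>" "?L x y = ?L x z"
      obtain r where "r < n^2" "A r i = x" "A r j = y" "?L x y = A r l"
        using row[OF x yz(1)] by blast
      moreover obtain t where "t < n^2" "A t i = x" "A t j = z" "?L x z = A t l"
        using row[OF x yz(2)] by blast
      ultimately show "y = z"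
        using ex1[OF lt(1,3,5) x cl[OF x yz(1)]] yz(3) by metis
    qed
    moreover have "(\<lambda>y. ?L x y) ` \<Lambda> \<subseteq> \<Lambda>" using cl x by auto
    ultimately show ?thesis using fin by (simp add: bij_betw_def endo_inj_surj)
  qed
  moreover have "bij_betw (\<lambda>x. ?L x y) \<Lambda> \<Lambda>" if y: "y \<in> \<Lambda>" for y
  proof -
    have "inj_on (\<lambda>x. ?L x y) \<Lambda>"
    proof (rule inj_onI)
      fix x z assume xz: "x \<in> \<Lambda>" "z \<in> \<Lambda>" "?L x y = ?L z y"
      obtain r where "r < n^2" "A r i = x" "A r j = y" "?L x y = A r l"
        using row[OF xz(1) y] by blast
      moreover obtain t where "t < n^2" "A t i = z" "A t j = y" "?L z y = A t l"
        using row[OF xz(2) y] by blast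
      ultimately show "x = z"
        using ex1[OF lt(2,3,6) y cl[OF xz(1) y]] xz(3) by metis
    qed
    moreover have "(\<lambda>x. ?L x y) ` \<Lambda> \<subseteq> \<Lambda>" using cl y by auto
    ultimately show ?thesis using fin by (simp add: bij_betw_def endo_inj_surj)
  qed
  ultimately show ?thesis by (simp add: latin_square_def)
qed

end

theory Submission
  imports Defs
begin

text \<open>
  Let \<open>\<sigma> i j\<close> be the parity of the permutation that sorts the rows of \<open>A\<close> lexicographically by
  columns \<open>i\<close> and \<open>j\<close>. The row, column and symbol parity of the square for \<open>i < j < l\<close> are
  \<open>\<sigma> i j + \<sigma> i l\<close>, \<open>\<sigma> j i + \<sigma> j l\<close> and \<open>\<sigma> l i + \<sigma> l j\<close>, and \<open>\<sigma> i j + \<sigma> j i\<close> is the parity of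
  \<open>n (n - 1) / 2\<close>, which is odd here. So \<open>\<sigma>\<close> is a tournament on the \<open>n + 1\<close> columns, and the
  equiparity squares are its cyclic triangles.

  Two distinct rows of an \<open>OA(n + 1, n)\<close> agree in exactly one column. Hence, among the pairs of rows
  ordered oppositely by columns \<open>i\<close> and \<open>j\<close>, each is counted by exactly one other column, and
  summing over these columns shows that all scores of the tournament have the same parity. At most
  \<open>n div 2 + 1\<close> scores therefore occur. Choosing one representative column for each score leaves at
  least \<open>n / 2\<close> other columns; each of them lies in a cyclic triangle with its representative, and a
  triangle arises from at most two of them.
\<close>

subsection \<open>Inversions and the parity of permutations\<close>

text \<open>Two labellings of one set are compared, with no permutation named, so that the rows of
  an array can be compared under several orders. Each discordant pair occurs once, oriented along
  \<open>f\<close>; pairs tied under \<open>f\<close> or \<open>g\<close> do not occur.\<close>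

definition inversions :: "'b set \<Rightarrow> ('b \<Rightarrow> nat) \<Rightarrow> ('b \<Rightarrow> nat) \<Rightarrow> ('b \<times> 'b) set" where
  "inversions S f g = {(x, y) \<in> S \<times> S. f x < f y \<and> g y < g x}"

lemma finite_inversions [simp]: "finite S \<Longrightarrow> finite (inversions S f g)"
  by (rule finite_subset[of _ "S \<times> S"]) (auto simp: inversions_def)

lemma card_inversions_reindex:
  assumes "bij_betw p S T"
  shows "card (inversions S (f \<circ> p) (g \<circ> p)) = card (inversions T f g)"
proof (rule bij_betw_same_card)
  have "inj_on p S" "p ` S = T"
    using assms by (auto simp: bij_betw_def)
  then show "bij_betw (map_prod p p) (inversions S (f \<circ> p) (g \<circ> p)) (inversions T f g)"
    unfolding bij_betw_def by (force simp: inversions_def inj_on_def)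
qed

text \<open>Of three linear orders at least two agree on any given pair, so the pair is discordant
  in none or in two of the three comparisons. Thus parities of discordance add along a chain of
  orders.\<close>

lemma even_card_inversions_triangle:
  assumes S: "finite S" and inj: "inj_on f S" "inj_on g S" "inj_on k S"
  shows "even (card (inversions S f g) + card (inversions S g k) + card (inversions S f k))"
proof -
  let ?X = "inversions S f g" and ?Y = "inversions S f k"
  have fin: "finite ?X" "finite ?Y"
    using S by simp_all
  have ne: "f x \<noteq> f y" "g x \<noteq> g y" "k x \<noteq> k y" if "x \<in> S" "y \<in> S" "x \<noteq> y" for x y
    using that inj by (auto simp: inj_on_def)
  \<comment> \<open>This is the symmetric difference of \<open>?X\<close> and \<open>?Y\<close>;
    pairs of \<open>?X - ?Y\<close> are swapped because \<open>g\<close> reverses them.\<close>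
  have "inversions S g k = (?Y - ?X) \<union> prod.swap ` (?X - ?Y)" (is "?L = ?R")
  proof (rule set_eqI)
    fix z :: "'a \<times> 'a"
    obtain x y where z: "z = (x, y)" by fastforce
    have "(x, y) \<in> ?R \<longleftrightarrow> (x, y) \<in> ?Y - ?X \<or> (y, x) \<in> ?X - ?Y"
      by force
    also have "\<dots> \<longleftrightarrow> (x, y) \<in> ?L"
      using ne[of x y] by (cases "x = y") (auto simp: inversions_def)
    finally show "z \<in> ?L \<longleftrightarrow> z \<in> ?R"
      using z by simp
  qed
  moreover have "(?Y - ?X) \<inter> prod.swap ` (?X - ?Y) = {}"
    by (auto simp: inversions_def)
  ultimately have "card (inversions S g k) = card (?Y - ?X) + card (?X - ?Y)"
    using fin by (simp add: card_Un_disjoint card_image)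
  moreover have "card ?X = card (?X \<inter> ?Y) + card (?X - ?Y)"
    using fin by (metis card_Int_Diff)
  moreover have "card ?Y = card (?X \<inter> ?Y) + card (?Y - ?X)"
    using fin by (metis Int_commute card_Int_Diff)
  ultimately have "card ?X + card (inversions S g k) + card ?Y
      = 2 * (card (?X \<inter> ?Y) + card (?X - ?Y) + card (?Y - ?X))" by simp
  then show ?thesis by (metis dvd_triv_left)
qed

text \<open>Besides \<open>(a, b)\<close>, every element \<open>z\<close> with label strictly
  between gives the two pairs \<open>(a, z)\<close> and \<open>(z, b)\<close>; all other pairs keep
  their order.\<close>

lemma odd_card_inversions_transpose:
  assumes S: "finite S" and h: "inj_on h S" and ab: "a \<in> S" "b \<in> S" "h a < h b"
  shows "odd (card (inversions S h (h \<circ> transpose a b)))"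
proof -
  define Z where "Z = {z \<in> S. h a < h z \<and> h z < h b}"
  have fin: "finite Z" using S by (simp add: Z_def)
  have hne: "h x \<noteq> h y" if "x \<in> S" "y \<in> S" "x \<noteq> y" for x y
    using that h by (auto simp: inj_on_def)
  have "inversions S h (h \<circ> transpose a b) = {(a, b)} \<union> (Pair a ` Z \<union> (\<lambda>z. (z, b)) ` Z)"
    (is "?L = ?R")
  proof (rule set_eqI)
    fix w :: "'a \<times> 'a"
    obtain x y where w: "w = (x, y)" by fastforce
    have "(x, y) \<in> ?L \<longleftrightarrow> (x, y) \<in> ?R"
      using ab hne[of x a] hne[of y a] hne[of x b] hne[of y b]
      by (auto simp: inversions_def Z_def transpose_def image_iff)
    then show "w \<in> ?L \<longleftrightarrow> w \<in> ?R" using w by simp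
  qed
  moreover have "card ({(a, b)} \<union> (Pair a ` Z \<union> (\<lambda>z. (z, b)) ` Z)) = 1 + (card Z + card Z)"
  proof -
    have "Pair a ` Z \<inter> (\<lambda>z. (z, b)) ` Z = {}" "(a, b) \<notin> Pair a ` Z \<union> (\<lambda>z. (z, b)) ` Z"
      by (auto simp: Z_def)
    then show ?thesis
      using fin by (simp add: card_Un_disjoint card_image inj_on_def)
  qed
  ultimately show ?thesis by simp
qed

text \<open>Induction on transpositions: each new factor flips both sides, by the triangle lemma for
  \<open>h\<close>, \<open>h \<circ> p\<close> and \<open>h \<circ> (?t \<circ> p)\<close>.\<close>

lemma evenperm_iff_even_inversions:
  assumes "finite S" "p permutes S" "inj_on h S"
  shows "evenperm p \<longleftrightarrow> even (card (inversions S h (h \<circ> p)))"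
  using assms(2,1)
proof (induction rule: permutes_induct)
  case id
  have "inversions S h h = {}" by (auto simp: inversions_def)
  then show ?case by simp
next
  case (swap a b p)
  let ?t = "transpose a b"
  have t: "?t permutes S" using swap by (simp add: permutes_swap_id)
  have inj: "inj_on (h \<circ> q) S" if "q permutes S" for q
    using that assms(3) by (metis comp_inj_on permutes_imp_bij bij_betw_def)
  have "odd (card (inversions S h (h \<circ> ?t)))"
  proof (cases "h a < h b")
    case True
    then show ?thesis using odd_card_inversions_transpose assms swap by metis
  next
    case False
    then have "h b < h a" using swap assms(3) by (metis inj_onD linorder_neqE_nat)
    then show ?thesis
      using odd_card_inversions_transpose assms swap by (metis transpose_commute)
  qed
  \<comment> \<open>Reindexing along \<open>p\<close> carries the odd count for a single
    transposition over to the last two of these orders.\<close>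
  also have "card (inversions S h (h \<circ> ?t)) = card (inversions S (h \<circ> p) (h \<circ> (?t \<circ> p)))"
    using card_inversions_reindex[OF permutes_imp_bij[OF \<open>p permutes S\<close>], of h "h \<circ> ?t"]
    by (simp add: o_assoc)
  finally have "odd (card (inversions S (h \<circ> p) (h \<circ> (?t \<circ> p))))" .
  moreover have "even (card (inversions S h (h \<circ> p)) + card (inversions S (h \<circ> p) (h \<circ> (?t \<circ> p)))
      + card (inversions S h (h \<circ> (?t \<circ> p))))"
    using assms swap t by (intro even_card_inversions_triangle inj permutes_compose) auto
  moreover have "permutation p"
    using swap assms(1) permutation_permutes by blast
  then have "evenperm (?t \<circ> p) \<longleftrightarrow> \<not> evenperm p"
    using swap by (simp add: evenperm_comp evenperm_swap permutation_swap_id)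
  moreover have "evenperm p \<longleftrightarrow> even (card (inversions S h (h \<circ> p)))"
    by (rule swap)
  ultimately show ?case by (metis even_add)
qed

lemma parity_on_eq_inversions:
  assumes "finite \<Lambda>" "bij_betw f \<Lambda> \<Lambda>" "inj_on h \<Lambda>"
  shows "parity_on \<Lambda> f = of_nat (card (inversions \<Lambda> h (h \<circ> f)))"
proof -
  have "inversions \<Lambda> h (h \<circ> restrict_id f \<Lambda>) = inversions \<Lambda> h (h \<circ> f)"
    by (auto simp: inversions_def restrict_id_def cong del: restrict_id_cong)
  with evenperm_iff_even_inversions[OF assms(1) permutes_restrict_id[OF assms(2)] assms(3)]
  have "evenperm (restrict_id f \<Lambda>) \<longleftrightarrow> even (card (inversions \<Lambda> h (h \<circ> f)))"
    by (simp only:)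
  then show ?thesis
    unfolding parity_on_def by (simp only: Z2.bit_eq_iff even_of_nat_iff split: if_split) simp
qed

subsection \<open>Cyclic triangles in tournaments\<close>

text \<open>If every out-neighbour of \<open>v\<close> were one of \<open>u\<close>, then
  \<open>u\<close>, which also beats \<open>v\<close>, would have the larger score. So
  \<open>v\<close> beats some \<open>w\<close> that \<open>u\<close> does not beat.\<close>

lemma ex_cyclic_triangle:
  fixes n :: nat and E :: "nat \<Rightarrow> nat \<Rightarrow> bool"
  defines "deg \<equiv> \<lambda>i. card {j. j \<le> n \<and> j \<noteq> i \<and> E i j}"
  assumes E: "\<And>i j. i \<le> n \<Longrightarrow> j \<le> n \<Longrightarrow> i \<noteq> j \<Longrightarrow> E i j \<longleftrightarrow> \<not> E j i"
    and uv: "u \<le> n" "v \<le> n" "E u v" "u \<noteq> v" "deg u = deg v"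
  obtains w where "w \<le> n" "w \<noteq> u" "w \<noteq> v" "E v w" "E w u"
proof -
  let ?N = "\<lambda>i. {j. j \<le> n \<and> j \<noteq> i \<and> E i j}"
  have "\<not> ?N v \<subseteq> ?N u"
  proof
    assume sub: "?N v \<subseteq> ?N u"
    moreover have "v \<in> ?N u" "v \<notin> ?N v" using uv by auto
    ultimately have "?N v \<subset> ?N u" by blast
    then have "deg v < deg u" unfolding deg_def by (intro psubset_card_mono) auto
    then show False using uv by simp
  qed
  then obtain w where w: "w \<le> n" "w \<noteq> v" "E v w" "w = u \<or> \<not> E u w" by auto
  then have "w \<noteq> u" using E uv by metis
  then show thesis using w E uv that by metis
qed

lemma cyclic_triangles_lower_bound:
  fixes n :: nat and E :: "nat \<Rightarrow> nat \<Rightarrow> bool"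
  defines "deg \<equiv> \<lambda>i. card {j. j \<le> n \<and> j \<noteq> i \<and> E i j}"
  assumes E: "\<And>i j. i \<le> n \<Longrightarrow> j \<le> n \<Longrightarrow> i \<noteq> j \<Longrightarrow> E i j \<longleftrightarrow> \<not> E j i"
    and par: "\<And>i j. i \<le> n \<Longrightarrow> j \<le> n \<Longrightarrow> even (deg i) \<longleftrightarrow> even (deg j)"
  shows "n \<le> 4 * card {(i, j, l). (i, j, l) \<in> ensemble_index (n + 1) \<and>
                      E i j = E j l \<and> E j l = E l i}"
proof -
  define Tri where "Tri = {(i, j, l). (i, j, l) \<in> ensemble_index (n + 1) \<and>
                      E i j = E j l \<and> E j l = E l i}"
  \<comment> \<open>Triples are sorted, whereas a cyclic triangle comes with a direction;
    \<open>vs\<close> keeps only its vertices, and the six cases below sort them.\<close>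
  define vs where "vs = (\<lambda>(i::nat, j, l). {i, j, l})"
  have finT: "finite Tri"
    by (rule finite_subset[of _ "{..n} \<times> {..n} \<times> {..n}"])
       (auto simp: Tri_def ensemble_index_def)
  have tri: "\<exists>t\<in>Tri. u \<in> vs t \<and> v \<in> vs t"
    if uvw: "u \<le> n" "v \<le> n" "w \<le> n" "u \<noteq> v" "w \<noteq> u" "w \<noteq> v" "E u v" "E v w" "E w u" for u v w
  proof -
    have nE: "\<not> E v u" "\<not> E w v" "\<not> E u w" using that E by metis+
    consider "u < v" "v < w" | "u < w" "w < v" | "v < u" "u < w" | "v < w" "w < u"
      | "w < u" "u < v" | "w < v" "v < u"
      using \<open>u \<noteq> v\<close> \<open>w \<noteq> u\<close> \<open>w \<noteq> v\<close> by linarith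
    then obtain t where "t \<in> Tri" "vs t = {u, v, w}"
    proof cases
      case 1
      then show ?thesis using uvw nE
        by (intro that[of "(u, v, w)"]) (auto simp: Tri_def ensemble_index_def vs_def)
    next
      case 2
      then show ?thesis using uvw nE
        by (intro that[of "(u, w, v)"]) (auto simp: Tri_def ensemble_index_def vs_def)
    next
      case 3
      then show ?thesis using uvw nE
        by (intro that[of "(v, u, w)"]) (auto simp: Tri_def ensemble_index_def vs_def)
    next
      case 4
      then show ?thesis using uvw nE
        by (intro that[of "(v, w, u)"]) (auto simp: Tri_def ensemble_index_def vs_def)
    next
      case 5
      then show ?thesis using uvw nE
        by (intro that[of "(w, u, v)"]) (auto simp: Tri_def ensemble_index_def vs_def)
    next
      case 6
      then show ?thesis using uvw nE
        by (intro that[of "(w, v, u)"]) (auto simp: Tri_def ensemble_index_def vs_def)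
    qed
    then show ?thesis by auto
  qed
  have same_deg: "\<exists>t\<in>Tri. u \<in> vs t \<and> v \<in> vs t"
    if uv: "u \<le> n" "v \<le> n" "u \<noteq> v" "deg u = deg v" for u v
  proof -
    have arc: "\<exists>t\<in>Tri. x \<in> vs t \<and> y \<in> vs t"
      if xy: "x \<le> n" "y \<le> n" "x \<noteq> y" "deg x = deg y" "E x y" for x y
    proof -
      obtain w where "w \<le> n" "w \<noteq> x" "w \<noteq> y" "E y w" "E w x"
        by (rule ex_cyclic_triangle[of n E x y, OF E xy(1,2,5,3) xy(4)[unfolded deg_def]]) blast+
      then show ?thesis using tri[of x y w] xy by blast
    qed
    have "E u v \<or> E v u" using E uv by blast
    then show ?thesis using arc[of u v] arc[of v u] uv by auto
  qed
  define rep where "rep d = (SOME v. v \<le> n \<and> deg v = d)" for d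
  have rep: "rep (deg v) \<le> n" "deg (rep (deg v)) = deg v" if "v \<le> n" for v
    using someI[of "\<lambda>w. w \<le> n \<and> deg w = deg v" v] that by (auto simp: rep_def)
  define D where "D = deg ` {..n}"
  define C where "C = {..n} - rep ` D"
  have "card D \<le> n div 2 + 1"
  proof -
    \<comment> \<open>Scores share one parity, so halving loses nothing and sends them into
      \<open>0, ..., n div 2\<close>.\<close>
    have "inj_on (\<lambda>d. d div 2) D"
    proof (rule inj_onI)
      fix x y assume "x \<in> D" "y \<in> D" and d: "x div 2 = y div 2"
      then have "even x \<longleftrightarrow> even y" using par by (auto simp: D_def)
      then show "x = y" using d by (metis even_iff_mod_2_eq_zero odd_iff_mod_2_eq_one div_mult_mod_eq)
    qed
    moreover have "(\<lambda>d. d div 2) ` D \<subseteq> {..n div 2}"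
    proof -
      have "deg v \<le> n" if "v \<le> n" for v
      proof -
        have "deg v \<le> card ({..n} - {v})"
          unfolding deg_def by (intro card_mono) auto
        then show ?thesis using that by simp
      qed
      then show ?thesis by (auto simp: D_def intro: div_le_mono)
    qed
    ultimately have "card D \<le> card {..n div 2}" by (intro card_inj_on_le) auto
    then show ?thesis by simp
  qed
  then have "card (rep ` D) \<le> n div 2 + 1"
    using card_image_le[of D rep] by (simp add: D_def)
  moreover have "card C \<ge> card {..n} - card (rep ` D)"
    unfolding C_def by (rule diff_card_le_card_Diff) (simp add: D_def)
  \<comment> \<open>At least \<open>(n + 1) - (n div 2 + 1)\<close> columns remain, which is at
    least half of \<open>n\<close>.\<close>
  ultimately have "n \<le> 2 * card C" by simp
  also have "card C \<le> 2 * card Tri"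
  proof -
    have "\<exists>t\<in>Tri. v \<in> vs t \<and> rep (deg v) \<in> vs t" if "v \<in> C" for v
      using that rep[of v] by (intro same_deg) (auto simp: C_def D_def)
    then obtain T where T: "\<And>v. v \<in> C \<Longrightarrow> T v \<in> Tri \<and> v \<in> vs (T v) \<and> rep (deg v) \<in> vs (T v)"
      by metis
    have fiber: "card {v \<in> C. T v = t} \<le> 2" for t
    proof (cases "\<exists>v\<in>C. T v = t")
      case True
      then obtain v where v: "v \<in> C" "T v = t" by blast
      let ?r = "rep (deg v)"
      \<comment> \<open>One of the at most three vertices of \<open>t\<close> is a representative
        and so lies outside \<open>C\<close>, leaving two for the fibre.\<close>
      have r: "?r \<in> vs t" "?r \<notin> C" using T v by (auto simp: C_def D_def)
      have vst: "finite (vs t)" "card (vs t) \<le> 3"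
        by (auto simp: vs_def card_insert_if split: prod.split)
      have "card {v \<in> C. T v = t} \<le> card (vs t - {?r})"
        using T r vst by (intro card_mono) auto
      then show ?thesis using r vst by simp
    next
      case False
      then have "{v \<in> C. T v = t} = {}" by blast
      then show ?thesis by (metis card.empty zero_le)
    qed
    have "C = (\<Union>t\<in>Tri. {v \<in> C. T v = t})" using T by auto
    then have "card C \<le> (\<Sum>t\<in>Tri. card {v \<in> C. T v = t})"
      using card_UN_le[OF finT] by metis
    also have "\<dots> \<le> (\<Sum>t\<in>Tri. 2)" by (intro sum_mono fiber)
    finally show ?thesis by simp
  qed
  finally show ?thesis by (simp add: Tri_def)
qed

subsection \<open>Parities of the ensemble\<close>

lemma less_mult_add_iff:
  fixes a b c d n :: nat
  assumes "b < n" "d < n"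
  shows "n * a + b < n * c + d \<longleftrightarrow> a < c \<or> a = c \<and> b < d"
proof -
  have *: "n * x + y < n * z + w" if "x < z" "y < n" for x y z w
  proof -
    have "n * Suc x \<le> n * z" using that by (intro mult_le_mono) auto
    then show ?thesis using that by simp
  qed
  show ?thesis
    using *[of a c b d] *[of c a d b] assms by (cases a c rule: linorder_cases) auto
qed

text \<open>The labelling \<open>h\<close> orders the alphabet so that parities can be counted by
  inversions. The number \<open>k\<close> of columns stays general until rows have to be
  counted.\<close>

locale labelled_orthogonal_array =
  fixes k n :: nat and \<Lambda> :: "'a set" and A :: "nat \<Rightarrow> nat \<Rightarrow> 'a" and h :: "'a \<Rightarrow> nat"
  assumes oa: "orthogonal_array k n \<Lambda> A" and h: "bij_betw h \<Lambda> {..<n}"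
begin

abbreviation "R \<equiv> {..<n^2}"
abbreviation "B c r \<equiv> h (A r c)"

lemma fin: "finite \<Lambda>" and card_Lambda: "card \<Lambda> = n"
  and entry: "r \<in> R \<Longrightarrow> c < k \<Longrightarrow> A r c \<in> \<Lambda>"
  using oa by (auto simp: orthogonal_array_def)

lemma inj_h: "inj_on h \<Lambda>"
  using h by (simp add: bij_betw_def)

lemma B_less: "r \<in> R \<Longrightarrow> c < k \<Longrightarrow> B c r < n"
  using entry h by (auto simp: bij_betw_def)

lemma B_eq_iff: "r \<in> R \<Longrightarrow> s \<in> R \<Longrightarrow> c < k \<Longrightarrow> B c r = B c s \<longleftrightarrow> A r c = A s c"
  using entry inj_h by (auto simp: inj_on_def)

lemma ex1_row:
  assumes "i < k" "j < k" "i \<noteq> j" "x \<in> \<Lambda>" "y \<in> \<Lambda>"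
  shows "\<exists>!r. r \<in> R \<and> A r i = x \<and> A r j = y"
  using oa assms by (simp add: orthogonal_array_def)

lemma row_eqI:
  assumes "i < k" "j < k" "i \<noteq> j" "r \<in> R" "s \<in> R" "A r i = A s i" "A r j = A s j"
  shows "r = s"
  using ex1_row[OF assms(1-3) entry[OF assms(4,1)] entry[OF assms(4,2)]] assms by metis

lemma ex_row:
  assumes "i < k" "j < k" "i \<noteq> j" "x \<in> \<Lambda>" "y \<in> \<Lambda>"
  obtains r where "r \<in> R" "A r i = x" "A r j = y"
  using ex1_row[OF assms] by blast

text \<open>This transports permutations of the alphabet to comparisons of the rows that share one
  entry.\<close>

lemma bij_betw_column:
  assumes "i < k" "j < k" "i \<noteq> j" "x \<in> \<Lambda>"
  shows "bij_betw (\<lambda>r. A r j) {r \<in> R. A r i = x} \<Lambda>"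
  unfolding bij_betw_def
proof
  show "inj_on (\<lambda>r. A r j) {r \<in> R. A r i = x}"
    using row_eqI[OF assms(1-3)] by (auto intro: inj_onI)
  show "(\<lambda>r. A r j) ` {r \<in> R. A r i = x} = \<Lambda>"
  proof
    show "(\<lambda>r. A r j) ` {r \<in> R. A r i = x} \<subseteq> \<Lambda>"
      using entry assms by auto
    show "\<Lambda> \<subseteq> (\<lambda>r. A r j) ` {r \<in> R. A r i = x}"
    proof
      fix y assume "y \<in> \<Lambda>"
      then obtain r where "r \<in> R" "A r i = x" "A r j = y" using ex_row assms by metis
      then show "y \<in> (\<lambda>r. A r j) ` {r \<in> R. A r i = x}" by auto
    qed
  qed
qed

section \<open>Lexicographic orders of the rows and their sorting parities\<close>

text \<open>A two-digit numeral in base \<open>n\<close>: labels lie below \<open>n\<close>, so its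
  order is the lexicographic one.\<close>

definition lex_rank :: "nat \<Rightarrow> nat \<Rightarrow> nat \<Rightarrow> nat" where
  "lex_rank i j r = n * B i r + B j r"

text \<open>Only the parity of this count matters. The reference order \<open>id\<close> of the rows
  cancels whenever two such counts are added.\<close>

definition \<sigma> :: "nat \<Rightarrow> nat \<Rightarrow> nat" where
  "\<sigma> i j = card (inversions R id (lex_rank i j))"

definition agreeing_inversions :: "nat \<Rightarrow> nat \<Rightarrow> nat \<Rightarrow> (nat \<times> nat) set" where
  "agreeing_inversions i j l = {(r, s) \<in> inversions R (B j) (B l). A r i = A s i}"

lemma finite_agreeing_inversions [simp]: "finite (agreeing_inversions i j l)"
  by (rule finite_subset[of _ "inversions R (B j) (B l)"]) (auto simp: agreeing_inversions_def)

lemma lex_rank_less_iff: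
  assumes "i < k" "j < k" "r \<in> R" "s \<in> R"
  shows "lex_rank i j r < lex_rank i j s \<longleftrightarrow> B i r < B i s \<or> B i r = B i s \<and> B j r < B j s"
  unfolding lex_rank_def using assms B_less by (intro less_mult_add_iff) auto

lemma inj_on_lex_rank:
  assumes "i < k" "j < k" "i \<noteq> j"
  shows "inj_on (lex_rank i j) R"
proof (rule inj_onI)
  fix r s assume rs: "r \<in> R" "s \<in> R" and eq: "lex_rank i j r = lex_rank i j s"
  then have "B i r = B i s" "B j r = B j s"
    using lex_rank_less_iff[of i j r s] lex_rank_less_iff[of i j s r] assms by auto
  then show "r = s" using row_eqI B_eq_iff rs assms by metis
qed

text \<open>Both lexicographic orders start with column \<open>i\<close>, so they can differ only on
  rows that agree there; the triangle lemma eliminates the order \<open>id\<close>.\<close>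

lemma even_sigma_common:
  assumes "i < k" "j < k" "l < k" "i \<noteq> j" "i \<noteq> l"
  shows "even (\<sigma> i j + \<sigma> i l + card (agreeing_inversions i j l))"
proof -
  have "inversions R (lex_rank i j) (lex_rank i l) = agreeing_inversions i j l"
    using assms B_eq_iff
    by (auto simp: inversions_def agreeing_inversions_def lex_rank_less_iff)
  moreover have "even (card (inversions R id (lex_rank i j))
      + card (inversions R (lex_rank i j) (lex_rank i l)) + card (inversions R id (lex_rank i l)))"
    using assms by (intro even_card_inversions_triangle inj_on_lex_rank) auto
  ultimately show ?thesis by (simp add: \<sigma>_def algebra_simps)
qed

text \<open>Rows tied in one of the two columns are ordered by the other one in both lexicographic
  orders, so only strictly discordant rows remain.\<close>

lemma even_sigma_swap:
  assumes "i < k" "j < k" "i \<noteq> j"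
  shows "even (\<sigma> i j + \<sigma> j i + card (inversions R (B i) (B j)))"
proof -
  have "inversions R (lex_rank i j) (lex_rank j i) = inversions R (B i) (B j)"
    using assms by (auto simp: inversions_def lex_rank_less_iff)
  moreover have "even (card (inversions R id (lex_rank i j))
      + card (inversions R (lex_rank i j) (lex_rank j i)) + card (inversions R id (lex_rank j i)))"
    using assms by (intro even_card_inversions_triangle inj_on_lex_rank) auto
  ultimately show ?thesis by (simp add: \<sigma>_def algebra_simps)
qed

text \<open>Rows are determined by their entries in columns \<open>i\<close> and \<open>j\<close>,
  so a discordant pair amounts to two independent increasing pairs of symbols. The count is the same
  for all pairs of columns.\<close>

lemma card_inversions_columns:
  assumes "i < k" "j < k" "i \<noteq> j"
  shows "card (inversions R (B i) (B j)) = (n * (n - 1) div 2)\<^sup>2"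
proof -
  let ?P = "{(x, y) \<in> \<Lambda> \<times> \<Lambda>. h x < h y}"
  \<comment> \<open>The second component lists \<open>s\<close> before \<open>r\<close>, which makes
    both components increasing.\<close>
  let ?F = "\<lambda>(r, s). ((A r i, A s i), (A s j, A r j))"
  have "bij_betw ?F (inversions R (B i) (B j)) (?P \<times> ?P)"
    unfolding bij_betw_def
  proof
    show "inj_on ?F (inversions R (B i) (B j))"
      using row_eqI[OF assms] by (auto intro!: inj_onI simp: inversions_def)
    show "?F ` inversions R (B i) (B j) = ?P \<times> ?P"
    proof
      show "?F ` inversions R (B i) (B j) \<subseteq> ?P \<times> ?P"
        using entry assms by (auto simp: inversions_def)
      show "?P \<times> ?P \<subseteq> ?F ` inversions R (B i) (B j)"
      proof clarify
        fix x x' y y' assume *: "x \<in> \<Lambda>" "x' \<in> \<Lambda>" "h x < h x'" "y \<in> \<Lambda>" "y' \<in> \<Lambda>" "h y < h y'"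
        obtain r where "r \<in> R" "A r i = x" "A r j = y'" using ex_row assms * by metis
        moreover obtain s where "s \<in> R" "A s i = x'" "A s j = y" using ex_row assms * by metis
        ultimately show "((x, x'), y, y') \<in> ?F ` inversions R (B i) (B j)"
          using * by (intro image_eqI[of _ _ "(r, s)"]) (auto simp: inversions_def)
      qed
    qed
  qed
  then have "card (inversions R (B i) (B j)) = card ?P * card ?P"
    by (simp add: bij_betw_same_card card_cartesian_product)
  moreover have "card ?P = n * (n - 1) div 2"
  proof -
    have "bij_betw (\<lambda>(x, y). (h y, h x)) ?P (SIGMA b:{..<n}. {..<b})"
      unfolding bij_betw_def
    proof
      show "inj_on (\<lambda>(x, y). (h y, h x)) ?P"
        using inj_h by (auto intro!: inj_onI dest: inj_onD)
      show "(\<lambda>(x, y). (h y, h x)) ` ?P = (SIGMA b:{..<n}. {..<b})"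
      proof
        have "h ` \<Lambda> = {..<n}" using h by (simp add: bij_betw_def)
        then show "(\<lambda>(x, y). (h y, h x)) ` ?P \<subseteq> (SIGMA b:{..<n}. {..<b})" by auto
        show "(SIGMA b:{..<n}. {..<b}) \<subseteq> (\<lambda>(x, y). (h y, h x)) ` ?P"
        proof (rule subrelI)
          fix a b assume "(a, b) \<in> (SIGMA b:{..<n}. {..<b})"
          then have "a \<in> h ` \<Lambda>" "b \<in> h ` \<Lambda>" "b < a" using \<open>h ` \<Lambda> = {..<n}\<close> by auto
          then show "(a, b) \<in> (\<lambda>(x, y). (h y, h x)) ` ?P" by force
        qed
      qed
    qed
    then have "card ?P = (\<Sum>b<n. b)"
      by (simp add: bij_betw_same_card)
    also have "\<dots> = n * (n - 1) div 2"
      by (simp add: Sum_Ico_nat lessThan_atLeast0)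
    finally show ?thesis .
  qed
  ultimately show ?thesis by (simp add: power2_eq_square)
qed

section \<open>Row, column and symbol parities as counts of row pairs\<close>

text \<open>One statement serves all three parities, with the row, column or symbol index of the
  square as fixed column \<open>i\<close>. Each permutation \<open>f x\<close> is read on the rows
  with entry \<open>x\<close> in column \<open>i\<close>, and these blocks are disjoint.\<close>

lemma sum_parity_on_eq_agreeing_inversions:
  assumes ijl: "i < k" "j < k" "l < k" "i \<noteq> j" "i \<noteq> l"
    and f: "\<And>r. r \<in> R \<Longrightarrow> f (A r i) (A r j) = A r l"
  shows "(\<Sum>x\<in>\<Lambda>. parity_on \<Lambda> (f x)) = of_nat (card (agreeing_inversions i j l))"
proof -
  let ?S = "\<lambda>x. {r \<in> R. A r i = x}"
  have "parity_on \<Lambda> (f x) = of_nat (card (inversions (?S x) (B j) (B l)))" if x: "x \<in> \<Lambda>" for x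
  proof -
    have bj: "bij_betw (\<lambda>r. A r j) (?S x) \<Lambda>" and bl: "bij_betw (\<lambda>r. A r l) (?S x) \<Lambda>"
      using bij_betw_column ijl x by simp_all
    have eq: "(f x \<circ> (\<lambda>r. A r j)) r = A r l" if "r \<in> ?S x" for r
      using f[of r] that by auto
    have "bij_betw (f x \<circ> (\<lambda>r. A r j)) (?S x) \<Lambda>"
      using bij_betw_cong[of "?S x" "f x \<circ> (\<lambda>r. A r j)" "\<lambda>r. A r l" \<Lambda>] eq bl by blast
    then have "bij_betw (f x) \<Lambda> \<Lambda>"
      using bij_betw_comp_iff[OF bj] by blast
    then have "parity_on \<Lambda> (f x) = of_nat (card (inversions \<Lambda> h (h \<circ> f x)))"
      using parity_on_eq_inversions fin inj_h by blast
    also have "card (inversions \<Lambda> h (h \<circ> f x)) =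
        card (inversions (?S x) (h \<circ> (\<lambda>r. A r j)) (h \<circ> f x \<circ> (\<lambda>r. A r j)))"
      by (rule card_inversions_reindex[OF bj, symmetric])
    also have "inversions (?S x) (h \<circ> (\<lambda>r. A r j)) (h \<circ> f x \<circ> (\<lambda>r. A r j)) =
        inversions (?S x) (B j) (B l)"
      using eq by (auto simp: inversions_def)
    finally show ?thesis .
  qed
  then have "(\<Sum>x\<in>\<Lambda>. parity_on \<Lambda> (f x)) =
      of_nat (\<Sum>x\<in>\<Lambda>. card (inversions (?S x) (B j) (B l)))"
    by simp
  also have "(\<Sum>x\<in>\<Lambda>. card (inversions (?S x) (B j) (B l))) =
      card (\<Union>x\<in>\<Lambda>. inversions (?S x) (B j) (B l))"
  proof (rule card_UN_disjoint[symmetric])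
    show "\<forall>x\<in>\<Lambda>. finite (inversions (?S x) (B j) (B l))" by simp
    show "\<forall>x\<in>\<Lambda>. \<forall>y\<in>\<Lambda>. x \<noteq> y \<longrightarrow>
        inversions (?S x) (B j) (B l) \<inter> inversions (?S y) (B j) (B l) = {}"
      by (auto simp: inversions_def)
  qed (rule fin)
  also have "(\<Union>x\<in>\<Lambda>. inversions (?S x) (B j) (B l)) = agreeing_inversions i j l"
    using entry ijl by (auto simp: inversions_def agreeing_inversions_def)
  finally show ?thesis .
qed

lemma equiparity_ensemble_square_iff:
  assumes "(i, j, l) \<in> ensemble_index k"
  shows "equiparity_latin_square \<Lambda> (ensemble_square n A i j l) \<longleftrightarrow>
    even (\<sigma> i j + \<sigma> i l) = even (\<sigma> j i + \<sigma> j l) \<and>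
    even (\<sigma> j i + \<sigma> j l) = even (\<sigma> l i + \<sigma> l j)"
proof -
  let ?L = "ensemble_square n A i j l"
  have ijl: "i < k" "j < k" "l < k" "i \<noteq> j" "i \<noteq> l" "j \<noteq> l"
    using assms by (auto simp: ensemble_index_def)
  have L: "?L (A r i) (A r j) = A r l" if "r \<in> R" for r
  proof -
    have "(THE s. s < n^2 \<and> A s i = A r i \<and> A s j = A r j) = r"
      using that row_eqI[OF ijl(1,2,4)] by (intro the_equality) auto
    then show ?thesis by (simp add: ensemble_square_def)
  qed
  \<comment> \<open>A row with entries \<open>A r i\<close> and \<open>y\<close> in columns
    \<open>i\<close> and \<open>j\<close> has symbol \<open>A r l\<close>; it agrees with
    \<open>r\<close> in columns \<open>i\<close> and \<open>l\<close>, hence equals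
    \<open>r\<close>.\<close>
  have S: "(THE y. y \<in> \<Lambda> \<and> ?L (A r i) y = A r l) = A r j" if r: "r \<in> R" for r
  proof (rule the_equality)
    show "A r j \<in> \<Lambda> \<and> ?L (A r i) (A r j) = A r l" using that L entry ijl by simp
  next
    fix y assume y: "y \<in> \<Lambda> \<and> ?L (A r i) y = A r l"
    then obtain s where s: "s \<in> R" "A s i = A r i" "A s j = y"
      using ex_row[OF ijl(1,2,4) entry[OF r ijl(1)]] by blast
    then have "A s l = A r l" using L[of s] y by simp
    then show "y = A r j" using row_eqI[OF ijl(1,3,5)] s that by metis
  qed
  have "row_parity \<Lambda> ?L = of_nat (card (agreeing_inversions i j l))"
    unfolding row_parity_def
    by (rule sum_parity_on_eq_agreeing_inversions) (use ijl L in auto)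
  moreover have "column_parity \<Lambda> ?L = of_nat (card (agreeing_inversions j i l))"
    unfolding column_parity_def
    by (rule sum_parity_on_eq_agreeing_inversions) (use ijl L in auto)
  moreover have "symbol_parity \<Lambda> ?L = of_nat (card (agreeing_inversions l i j))"
    unfolding symbol_parity_def
    by (rule sum_parity_on_eq_agreeing_inversions) (use ijl S in auto)
  moreover have "latin_square \<Lambda> ?L"
    using latin_square_ensemble_square oa assms by blast
  ultimately have "equiparity_latin_square \<Lambda> ?L \<longleftrightarrow>
      even (card (agreeing_inversions i j l)) = even (card (agreeing_inversions j i l)) \<and>
      even (card (agreeing_inversions j i l)) = even (card (agreeing_inversions l i j))"
    by (simp only: equiparity_latin_square_def Z2.bit_eq_iff even_of_nat_iff) simp
  also have "\<dots> \<longleftrightarrow> even (\<sigma> i j + \<sigma> i l) = even (\<sigma> j i + \<sigma> j l) \<and>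
      even (\<sigma> j i + \<sigma> j l) = even (\<sigma> l i + \<sigma> l j)"
    using even_sigma_common[of i j l] even_sigma_common[of j i l] even_sigma_common[of l i j] ijl
    by (metis even_add)
  finally show ?thesis .
qed

section \<open>Arrays with \<open>n + 1\<close> columns\<close>

text \<open>For each column, \<open>n - 1\<close> other rows agree there with \<open>r\<close>.
  These \<open>n + 1\<close> sets are disjoint, so together they contain
  \<open>(n + 1) * (n - 1)\<close> rows, which is all rows but \<open>r\<close>.\<close>

lemma rows_agree_somewhere:
  assumes k: "k = n + 1" and n: "n > 0" and rs: "r \<in> R" "s \<in> R" "r \<noteq> s"
  shows "\<exists>c<k. A r c = A s c"
proof -
  let ?S = "\<lambda>c. {s \<in> R. A s c = A r c} - {r}"
  have card_S: "card (?S c) = n - 1" if c: "c < k" for c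
  proof -
    obtain d where d: "d < k" "d \<noteq> c"
    proof (cases "c = 0")
      case True then show ?thesis using that[of 1] k n by simp
    next
      case False then show ?thesis using that[of 0] k n by simp
    qed
    have "card {s \<in> R. A s c = A r c} = n"
      using bij_betw_same_card[OF bij_betw_column[OF c d(1) d(2)[symmetric] entry[OF rs(1) c]]]
      by (simp add: card_Lambda)
    then show ?thesis using rs by simp
  qed
  have "card (\<Union>c<k. ?S c) = (\<Sum>c<k. card (?S c))"
  proof (rule card_UN_disjoint)
    have "t = r" if "c < k" "d < k" "c \<noteq> d" "t \<in> R" "A t c = A r c" "A t d = A r d" for c d t
      using row_eqI that rs by blast
    then show "\<forall>c\<in>{..<k}. \<forall>d\<in>{..<k}. c \<noteq> d \<longrightarrow> ?S c \<inter> ?S d = {}"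
      by blast
  qed simp_all
  also have "\<dots> = (n + 1) * (n - 1)"
    using card_S k by simp
  also have "\<dots> = card (R - {r})"
    using rs n by (simp add: power2_eq_square algebra_simps)
  finally have "(\<Union>c<k. ?S c) = R - {r}"
    by (intro card_subset_eq) auto
  then have "s \<in> (\<Union>c<k. ?S c)" using rs by blast
  then show ?thesis by auto
qed

text \<open>Discordant rows are distinct, so exactly one column has them agree, and it is neither
  \<open>i\<close> nor \<open>j\<close>.\<close>

lemma card_inversions_columns_eq_sum:
  assumes k: "k = n + 1" and n: "n > 0" and ij: "i < k" "j < k" "i \<noteq> j"
  shows "card (inversions R (B i) (B j)) =
    (\<Sum>c\<in>{..<k} - {i, j}. card (agreeing_inversions c i j))"
proof -
  have "inversions R (B i) (B j) = (\<Union>c\<in>{..<k} - {i, j}. agreeing_inversions c i j)" (is "?X = ?Y")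
  proof
    show "?Y \<subseteq> ?X" by (auto simp: agreeing_inversions_def)
    show "?X \<subseteq> ?Y"
    proof clarify
      fix r s assume rs: "(r, s) \<in> inversions R (B i) (B j)"
      then have "r \<in> R" "s \<in> R" "r \<noteq> s" by (auto simp: inversions_def)
      then obtain c where c: "c < k" "A r c = A s c" using rows_agree_somewhere k n by blast
      then have "c \<in> {..<k} - {i, j}" using rs by (auto simp: inversions_def)
      then show "(r, s) \<in> ?Y" using c rs by (auto simp: agreeing_inversions_def)
    qed
  qed
  also have "card \<dots> = (\<Sum>c\<in>{..<k} - {i, j}. card (agreeing_inversions c i j))"
  proof (rule card_UN_disjoint)
    have "c = d" if "c < k" "d < k" "(r, s) \<in> agreeing_inversions c i j"
      "(r, s) \<in> agreeing_inversions d i j" for c d r s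
    proof (rule ccontr)
      assume "c \<noteq> d"
      then have "r = s" using that row_eqI[of c d r s] by (auto simp: agreeing_inversions_def inversions_def)
      then show False using that by (simp add: agreeing_inversions_def inversions_def)
    qed
    then show "\<forall>c\<in>{..<k} - {i, j}. \<forall>d\<in>{..<k} - {i, j}. c \<noteq> d \<longrightarrow>
        agreeing_inversions c i j \<inter> agreeing_inversions d i j = {}"
      by fast
  qed auto
  finally show ?thesis .
qed

text \<open>Modulo 2, the terms \<open>\<sigma> i c + \<sigma> j c\<close> with \<open>c\<close>
  outside \<open>{i, j}\<close> add up to \<open>?N\<close>, and so does
  \<open>\<sigma> i j + \<sigma> j i\<close>; the two contributions cancel.\<close>

lemma even_sum_sigma_iff:
  assumes k: "k = n + 1" and n: "n > 0" and ij: "i < k" "j < k"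
  shows "even (\<Sum>c\<in>{..<k} - {i}. \<sigma> i c) \<longleftrightarrow> even (\<Sum>c\<in>{..<k} - {j}. \<sigma> j c)"
proof (cases "i = j")
  case False
  let ?C = "{..<k} - {i, j}" and ?N = "card (inversions R (B i) (B j))"
  have "(\<Sum>c\<in>{..<k} - {i}. \<sigma> i c) = \<sigma> i j + (\<Sum>c\<in>{..<k} - {i} - {j}. \<sigma> i c)"
    using ij False by (intro sum.remove) auto
  moreover have "(\<Sum>c\<in>{..<k} - {j}. \<sigma> j c) = \<sigma> j i + (\<Sum>c\<in>{..<k} - {j} - {i}. \<sigma> j c)"
    using ij False by (intro sum.remove) auto
  moreover have "{..<k} - {i} - {j} = ?C" "{..<k} - {j} - {i} = ?C" by auto
  ultimately have split: "(\<Sum>c\<in>{..<k} - {i}. \<sigma> i c) + (\<Sum>c\<in>{..<k} - {j}. \<sigma> j c)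
      = (\<sigma> i j + \<sigma> j i) + (\<Sum>c\<in>?C. \<sigma> i c + \<sigma> j c)"
    by (simp add: sum.distrib)
  have "even (\<sigma> i c + \<sigma> j c + card (agreeing_inversions c i j))" if c: "c \<in> ?C" for c
  proof -
    \<comment> \<open>Exchanging the indices of \<open>\<sigma> i c\<close> and of
      \<open>\<sigma> j c\<close> costs the same number twice, so nothing modulo 2.\<close>
    have "card (inversions R (B i) (B c)) = card (inversions R (B j) (B c))"
      using card_inversions_columns c ij by simp
    moreover have "even (\<sigma> i c + \<sigma> c i + card (inversions R (B i) (B c)))"
      "even (\<sigma> j c + \<sigma> c j + card (inversions R (B j) (B c)))"
      "even (\<sigma> c i + \<sigma> c j + card (agreeing_inversions c i j))"
      using even_sigma_swap[of i c] even_sigma_swap[of j c] even_sigma_common[of c i j] c ij by auto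
    ultimately show ?thesis by (metis even_add)
  qed
  then have "even (\<Sum>c\<in>?C. \<sigma> i c + \<sigma> j c + card (agreeing_inversions c i j))"
    by (intro dvd_sum) auto
  then have "even ((\<Sum>c\<in>?C. \<sigma> i c + \<sigma> j c) + ?N)"
    using card_inversions_columns_eq_sum[OF k n ij False] by (simp add: sum.distrib)
  moreover have "even (\<sigma> i j + \<sigma> j i + ?N)"
    using even_sigma_swap ij False by blast
  ultimately have "even ((\<Sum>c\<in>{..<k} - {i}. \<sigma> i c) + (\<Sum>c\<in>{..<k} - {j}. \<sigma> j c))"
    unfolding split by (simp only: even_add)
  then show ?thesis by (simp only: even_add)
qed simp

end

section \<open>From cyclic triangles to equiparity squares\<close>

theorem theorem6p10:
  fixes n :: nat and \<Lambda> :: "'a set" and A :: "nat \<Rightarrow> nat \<Rightarrow> 'a"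
  assumes "n \<ge> 2"
    and "[n = 2] (mod 4) \<or> [n = 3] (mod 4)"
    and "orthogonal_array (n + 1) n \<Lambda> A"
  shows "int (card {(i, j, l). (i, j, l) \<in> ensemble_index (n + 1) \<and>
                      equiparity_latin_square \<Lambda> (ensemble_square n A i j l)})
           \<ge> \<lceil>real n / 4\<rceil>"
proof -
  have "finite \<Lambda>" "card \<Lambda> = n" using assms(3) by (auto simp: orthogonal_array_def)
  then obtain h where "bij_betw h \<Lambda> {..<n}"
    using ex_bij_betw_finite_nat[of \<Lambda>] by (auto simp: atLeast0LessThan)
  then interpret labelled_orthogonal_array "n + 1" n \<Lambda> A h
    using assms(3) by unfold_locales
  define E where "E i j \<longleftrightarrow> odd (\<sigma> i j)" for i j
  \<comment> \<open>This oddness makes \<open>E\<close> a tournament; it is where the residue of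
    \<open>n\<close> modulo 4 enters.\<close>
  have odd_N: "odd ((n * (n - 1) div 2)\<^sup>2)"
  proof -
    have "n mod 4 = 2 \<or> n mod 4 = 3" using assms(2) by (auto simp: cong_def)
    then obtain q where "n = 4 * q + 2 \<or> n = 4 * q + 3" by (metis mult_div_mod_eq)
    then have "n * (n - 1) = 2 * ((2 * q + 1) * (4 * q + 1)) \<or>
        n * (n - 1) = 2 * ((4 * q + 3) * (2 * q + 1))"
      by (auto simp: algebra_simps)
    then have "odd (n * (n - 1) div 2)"
      by (elim disjE) simp_all
    then show ?thesis by simp
  qed
  have tournament: "E i j \<longleftrightarrow> \<not> E j i" if "i \<le> n" "j \<le> n" "i \<noteq> j" for i j
    using even_sigma_swap[of i j] card_inversions_columns[of i j] odd_N that
    by (auto simp: E_def)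
  have deg: "even (card {j. j \<le> n \<and> j \<noteq> i \<and> E i j}) \<longleftrightarrow> even (\<Sum>c\<in>{..<n + 1} - {i}. \<sigma> i c)" for i
  proof -
    have "{j. j \<le> n \<and> j \<noteq> i \<and> E i j} = {c \<in> {..<n + 1} - {i}. odd (\<sigma> i c)}"
      by (auto simp: E_def)
    then show ?thesis by (subst even_sum_iff) simp_all
  qed
  have "n \<le> 4 * card {(i, j, l). (i, j, l) \<in> ensemble_index (n + 1) \<and>
      E i j = E j l \<and> E j l = E l i}"
  proof (rule cyclic_triangles_lower_bound[OF tournament])
    fix i j assume "i \<le> n" "j \<le> n"
    then show "even (card {l. l \<le> n \<and> l \<noteq> i \<and> E i l}) \<longleftrightarrow>
        even (card {l. l \<le> n \<and> l \<noteq> j \<and> E j l})"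
      unfolding deg using assms(1) by (intro even_sum_sigma_iff) auto
  qed
  also have "card {(i, j, l). (i, j, l) \<in> ensemble_index (n + 1) \<and> E i j = E j l \<and> E j l = E l i}
      \<le> card {(i, j, l). (i, j, l) \<in> ensemble_index (n + 1) \<and>
                      equiparity_latin_square \<Lambda> (ensemble_square n A i j l)}"
  proof (rule card_mono)
    show "finite {(i, j, l). (i, j, l) \<in> ensemble_index (n + 1) \<and>
                      equiparity_latin_square \<Lambda> (ensemble_square n A i j l)}"
      by (rule finite_subset[of _ "{..n} \<times> {..n} \<times> {..n}"]) (auto simp: ensemble_index_def)
    have "equiparity_latin_square \<Lambda> (ensemble_square n A i j l)"
      if idx: "(i, j, l) \<in> ensemble_index (n + 1)" and cyc: "E i j = E j l" "E j l = E l i" for i j l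
    proof -
      have "i \<le> n" "j \<le> n" "l \<le> n" "i \<noteq> j" "i \<noteq> l" "j \<noteq> l"
        using idx by (auto simp: ensemble_index_def)
      \<comment> \<open>If the three cyclic arcs share the value \<open>e\<close>, each parity is
        \<open>e\<close> plus its negation, so all three equal 1.\<close>
      then have "E j i = (\<not> E i j)" "E i l = (\<not> E l i)" "E l j = (\<not> E j l)"
        using tournament by blast+
      then show ?thesis
        using cyc unfolding equiparity_ensemble_square_iff[OF idx] even_add E_def by argo
    qed
    then show "{(i, j, l). (i, j, l) \<in> ensemble_index (n + 1) \<and> E i j = E j l \<and> E j l = E l i}
      \<subseteq> {(i, j, l). (i, j, l) \<in> ensemble_index (n + 1) \<and>
                      equiparity_latin_square \<Lambda> (ensemble_square n A i j l)}"
      by auto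
  qed
  finally show ?thesis by linarith
qed

end
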